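(* Let $\Gamma$ be a smooth, strictly convex, closed curve of length $2\pi$ in the plane, with curvature $\kappa(s)$ as a function of arc length $s$, and let $\lambda_\Gamma$ be the lowest eigenvalue of the Schrödinger operator $H_\Gamma = -\frac{d^2}{ds^2} + \kappa(s)^2$ in $L^2([0,2\pi))$ with periodic boundary conditions. Assume additionally that for every $\theta\in\Omega=\mathbb{R}/2\pi\mathbb{Z}$ the interval $[\theta,\theta+\frac{\pi}{2})\subset\Omega$ contains at least one critical angle of $\Gamma$. Then $\lambda_\Gamma\ge 1$.
   Context: Let $\Omega := \mathbb{R}/2\pi\mathbb{Z}$. For a smooth closed plane curve $\Gamma$ of length $2\pi$ parametrized by arc length $s\in\Omega$, let $\phi(s)$ be the angle between the tangent of $\Gamma$ at $s$ and a fixed axis, so that the tangent vector is $(\cos\phi(s),\sin\phi(s))$ and $\phi'(s)=\kappa(s)$ is the curvature. Strictly convex means (with suitable orientation) $\phi'>0$ everywhere, with total turning $\int_\Omega \phi'(s)\,ds = 2\pi$; closedness means $\int_\Omega\cos\phi(s)\,ds=\int_\Omega\sin\phi(s)\,ds=0$. Angles are taken modulo $2\pi$, so $\phi$ is regarded as a map $\phi:\Omega\to\Omega$. A point $s\in\Omega$ is called a critical point of $\Gamma$ if $\phi(s+\pi)=\phi(s)+\pi$ in $\Omega$; if $s$ is a critical point, then $\phi(s)\in\Omega$ is called a critical angle of $\Gamma$. Equivalently, $\lambda_\Gamma$ is the minimum of $\int_\Omega (R'(s)^2+\kappa(s)^2R(s)^2)\,ds \big/ \int_\Omega R(s)^2\,ds$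 over nonzero $2\pi$-periodic $R$ in the Sobolev space $H^1(\Omega)$. *)

theory Defs
  imports "HOL-Analysis.Analysis" "HOL-Library.Real_Mod"
begin

text \<open>
  Functions on \<open>\<Omega> = \<real>/2\<pi>\<int>\<close> are represented by functions on the real line, the plane by
  \<^typ>\<open>complex\<close>, so that \<^term>\<open>cis \<alpha>\<close> is the unit vector \<open>(cos \<alpha>, sin \<alpha>)\<close>.
\<close>

definition smooth :: "(real \<Rightarrow> 'a::real_normed_vector) \<Rightarrow> bool" where
  "smooth f \<longleftrightarrow>
     (\<exists>D :: nat \<Rightarrow> real \<Rightarrow> 'a. D 0 = f \<and>
        (\<forall>n t. (D n has_vector_derivative D (Suc n) t) (at t)))"

definition arclength_loop :: "(real \<Rightarrow> complex) \<Rightarrow> bool" where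
  "arclength_loop \<gamma> \<longleftrightarrow>
     smooth \<gamma> \<and> (\<forall>s. \<gamma> (s + 2 * pi) = \<gamma> s) \<and>
     (\<forall>s. norm (vector_derivative \<gamma> (at s)) = 1)"

text \<open>
  The tangent angle is a real-valued lift of the \<open>\<Omega>\<close>-valued angle. A smooth loop has such a
  lift, unique up to a constant in \<open>2\<pi>\<int>\<close>, and every continuous lift is smooth.
\<close>

definition tangent_angle :: "(real \<Rightarrow> complex) \<Rightarrow> (real \<Rightarrow> real) \<Rightarrow> bool" where
  "tangent_angle \<gamma> \<phi> \<longleftrightarrow>
     smooth \<phi> \<and> (\<forall>s. vector_derivative \<gamma> (at s) = cis (\<phi> s))"

definition strictly_convex_loop :: "(real \<Rightarrow> complex) \<Rightarrow> (real \<Rightarrow> real) \<Rightarrow> bool" where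
  "strictly_convex_loop \<gamma> \<phi> \<longleftrightarrow>
     arclength_loop \<gamma> \<and> tangent_angle \<gamma> \<phi> \<and>
     (\<forall>s. deriv \<phi> s > 0) \<and> integral {0..2 * pi} (deriv \<phi>) = 2 * pi"

definition critical_point :: "(real \<Rightarrow> real) \<Rightarrow> real \<Rightarrow> bool" where
  "critical_point \<phi> s \<longleftrightarrow> [\<phi> (s + pi) = \<phi> s + pi] (rmod (2 * pi))"

definition critical_angle :: "(real \<Rightarrow> real) \<Rightarrow> real \<Rightarrow> bool" where
  "critical_angle \<phi> \<alpha> \<longleftrightarrow> (\<exists>s. critical_point \<phi> s \<and> [\<alpha> = \<phi> s] (rmod (2 * pi)))"

definition square_integrable :: "(real \<Rightarrow> complex) \<Rightarrow> bool" where
  "square_integrable f \<longleftrightarrow>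
     set_borel_measurable lebesgue {0..2 * pi} f \<and>
     set_integrable lebesgue {0..2 * pi} (\<lambda>s. (norm (f s))\<^sup>2)"

definition antiderivative_of :: "(real \<Rightarrow> complex) \<Rightarrow> (real \<Rightarrow> complex) \<Rightarrow> bool" where
  "antiderivative_of f g \<longleftrightarrow>
     set_integrable lebesgue {0..2 * pi} g \<and>
     (\<forall>s\<in>{0..2 * pi}. f s = f 0 + (LINT t:{0..s}|lebesgue. g t))"

text \<open>
  \<open>H2_periodic u u1 u2\<close>: \<open>u\<close> is the continuous representative of an element of the periodic
  Sobolev space \<open>H\<^sup>2\<close> over \<open>[0, 2\<pi>]\<close>, with weak derivatives \<open>u1\<close>, \<open>u2\<close>. That is, \<open>u\<close> and
  \<open>u1\<close> are absolutely continuous and agree at the two end points, and \<open>u2\<close> lies in \<open>L\<^sup>2\<close>.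
\<close>

definition H2_periodic ::
  "(real \<Rightarrow> complex) \<Rightarrow> (real \<Rightarrow> complex) \<Rightarrow> (real \<Rightarrow> complex) \<Rightarrow> bool" where
  "H2_periodic u u1 u2 \<longleftrightarrow>
     antiderivative_of u u1 \<and> antiderivative_of u1 u2 \<and> square_integrable u2 \<and>
     u (2 * pi) = u 0 \<and> u1 (2 * pi) = u1 0"

text \<open>
  Graph of \<open>H = - d\<^sup>2/ds\<^sup>2 + V\<close> with periodic boundary conditions, on the domain \<open>H\<^sup>2\<close>; this is
  the self-adjoint realisation for bounded \<open>V\<close>. Images are taken up to null sets.
\<close>

definition schroedinger ::
  "(real \<Rightarrow> real) \<Rightarrow> (real \<Rightarrow> complex) \<Rightarrow> (real \<Rightarrow> complex) \<Rightarrow> bool" where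
  "schroedinger V u w \<longleftrightarrow>
     (\<exists>u1 u2. H2_periodic u u1 u2 \<and>
        (AE s in lebesgue. s \<in> {0..2 * pi} \<longrightarrow> w s = - u2 s + of_real (V s) * u s))"

text \<open>Real eigenvalues are enough, since the operator is self-adjoint.\<close>

definition schroedinger_eigenvalue :: "(real \<Rightarrow> real) \<Rightarrow> real \<Rightarrow> bool" where
  "schroedinger_eigenvalue V \<mu> \<longleftrightarrow>
     (\<exists>u. schroedinger V u (\<lambda>s. of_real \<mu> * u s) \<and>
        \<not> (AE s in lebesgue. s \<in> {0..2 * pi} \<longrightarrow> u s = 0))"

definition lowest_eigenvalue :: "(real \<Rightarrow> real) \<Rightarrow> real \<Rightarrow> bool" where
  "lowest_eigenvalue V \<mu> \<longleftrightarrow>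
     schroedinger_eigenvalue V \<mu> \<and> (\<forall>\<nu>. schroedinger_eigenvalue V \<nu> \<longrightarrow> \<mu> \<le> \<nu>)"

end

theory Submission
  imports Defs
begin

text \<open>
  For a real eigenfunction \<open>U\<close> with eigenvalue \<open>\<lambda>\<close> consider the closed plane curve \<open>Y = U (cos \<phi>, sin \<phi>)\<close>.
  Since \<open>|Y'|\<^sup>2 = U'\<^sup>2 + \<kappa>\<^sup>2 U\<^sup>2\<close>, the quadratic form \<open>Q n = \<integral> (Y \<bullet> n)'\<^sup>2 - (Y \<bullet> n)\<^sup>2\<close> on the plane
  has trace \<open>(\<lambda> - 1) \<integral> U\<^sup>2\<close>. If \<open>n\<close> is normal to the direction of a critical angle, then \<open>Y \<bullet> n\<close>
  vanishes at two antipodal points of the loop, and Wirtinger's inequality on both arcs gives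
  \<open>Q n \<ge> 0\<close>. But a quadratic form of negative trace is negative on a whole quarter circle of
  directions, so \<open>\<lambda> < 1\<close> is impossible when every quarter circle contains a critical angle.
\<close>

section \<open>Wirtinger's inequality with antipodal zeros\<close>

text \<open>The zero of \<open>sin (t - s)\<close> at \<open>x\<close> is simple, so
  \<open>f t / sin (t - s)\<close> has a finite limit there by comparing difference quotients, while
  the second factor \<open>f t\<close> tends to 0. The filter is relative to \<open>S\<close> so
  that end points of an interval are covered.\<close>

lemma cot_weight_tendsto_zero:
  fixes f :: "real \<Rightarrow> real"
  assumes f: "(f has_real_derivative D) (at x within S)"
    and "f x = 0" and sin0: "sin (x - s) = 0"
  shows "((\<lambda>t. (f t)\<^sup>2 * cos (t - s) / sin (t - s)) \<longlongrightarrow> 0) (at x within S)"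
proof -
  have cos_nz: "cos (x - s) \<noteq> 0"
    using sin_cos_squared_add[of "x - s"] sin0 by auto
  have sin: "((\<lambda>t. sin (t - s)) has_real_derivative cos (x - s)) (at x within S)"
    by (auto intro!: derivative_eq_intros)
  have "((\<lambda>t. ((f t - f x) / (t - x)) / ((sin (t - s) - sin (x - s)) / (t - x)))
          \<longlongrightarrow> D / cos (x - s)) (at x within S)"
    using f sin cos_nz unfolding has_field_derivative_iff by (intro tendsto_divide)
  moreover have "\<forall>\<^sub>F t in at x within S.
      ((f t - f x) / (t - x)) / ((sin (t - s) - sin (x - s)) / (t - x)) = f t / sin (t - s)"
    by (auto simp: eventually_at_filter assms(2) sin0)
  ultimately have quotient: "((\<lambda>t. f t / sin (t - s)) \<longlongrightarrow> D / cos (x - s)) (at x within S)"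
    by (rule Lim_transform_eventually)
  have "(f \<longlongrightarrow> 0) (at x within S)"
    using DERIV_continuous[OF f] assms(2) by (simp add: continuous_within)
  moreover have "((\<lambda>t. cos (t - s)) \<longlongrightarrow> cos (x - s)) (at x within S)"
    by (intro tendsto_intros)
  ultimately have "((\<lambda>t. f t * (f t / sin (t - s)) * cos (t - s))
      \<longlongrightarrow> 0 * (D / cos (x - s)) * cos (x - s)) (at x within S)"
    using quotient by (intro tendsto_mult)
  then show ?thesis
    by (simp add: power2_eq_square)
qed

text \<open>
  Away from the zeros of \<open>sin (t - s)\<close> one has
  \<open>f'\<^sup>2 - f\<^sup>2 = (f' - f cot)\<^sup>2 + (f\<^sup>2 cot)'\<close>, and \<open>f\<^sup>2 cot\<close> extends continuously by \<open>0\<close>, which is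
  also the value produced by division by zero.
\<close>

lemma wirtinger_antipodal_zeros:
  fixes f f' :: "real \<Rightarrow> real"
  assumes deriv: "\<And>t. t \<in> {0..2 * pi} \<Longrightarrow> (f has_real_derivative f' t) (at t within {0..2 * pi})"
    and cont: "continuous_on {0..2 * pi} f'"
    and periodic: "(f (2 * pi))\<^sup>2 = (f 0)\<^sup>2"
    and zeros: "\<And>t. t \<in> {0..2 * pi} \<Longrightarrow> sin (t - s) = 0 \<Longrightarrow> f t = 0"
  shows "integral {0..2 * pi} (\<lambda>t. (f' t)\<^sup>2 - (f t)\<^sup>2) \<ge> 0"
proof -
  define g where "g t = (f t)\<^sup>2 * cos (t - s) / sin (t - s)" for t
  define g' where "g' t = 2 * f t * f' t * (cos (t - s) / sin (t - s))
    - (f t)\<^sup>2 * (1 + (cos (t - s) / sin (t - s))\<^sup>2)" for t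
  define Z where "Z = {t \<in> {0..2 * pi}. sin (t - s) = 0}"
  have contf: "continuous_on {0..2 * pi} f"
    using DERIV_continuous_on deriv by blast
  \<comment> \<open>If \<open>t - s = n * pi\<close>, then
    \<open>\<bar>n\<bar> \<le> \<bar>t - s\<bar>\<close> because \<open>pi > 1\<close>, and
    \<open>\<bar>t - s\<bar> \<le> 8 + \<bar>s\<bar>\<close> because \<open>2 * pi < 8\<close>.
    Hence only finitely many \<open>n\<close> occur.\<close>
  have "Z \<subseteq> (\<lambda>n::int. s + of_int n * pi) ` {- \<lceil>8 + \<bar>s\<bar>\<rceil>..\<lceil>8 + \<bar>s\<bar>\<rceil>}"
  proof
    fix t assume "t \<in> Z"
    then obtain n :: int where n: "t - s = of_int n * pi" and t: "0 \<le> t" "t \<le> 2 * pi"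
      unfolding Z_def using sin_zero_iff_int2 by auto
    have "\<bar>real_of_int n\<bar> * 1 \<le> \<bar>real_of_int n\<bar> * pi"
      using pi_gt3 by (intro mult_left_mono) auto
    also have "\<dots> = \<bar>t - s\<bar>"
      unfolding n by (simp add: abs_mult)
    also have "\<dots> \<le> 8 + \<bar>s\<bar>"
      using t pi_less_4 by linarith
    finally have "\<bar>n\<bar> \<le> \<lceil>8 + \<bar>s\<bar>\<rceil>"
      by linarith
    then show "t \<in> (\<lambda>n::int. s + of_int n * pi) ` {- \<lceil>8 + \<bar>s\<bar>\<rceil>..\<lceil>8 + \<bar>s\<bar>\<rceil>}"
      using n by (intro image_eqI[of _ _ n]) (auto simp: algebra_simps)
  qed
  then have "finite Z"
    using finite_subset by blast
  have contg: "continuous_on {0..2 * pi} g"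
    unfolding continuous_on_eq_continuous_within
  proof
    fix x assume x: "x \<in> {0..2 * pi}"
    show "continuous (at x within {0..2 * pi}) g"
    proof (cases "sin (x - s) = 0")
      case True
      then show ?thesis
        using cot_weight_tendsto_zero[OF deriv[OF x] zeros[OF x True] True]
        by (simp add: continuous_within g_def[abs_def])
    next
      case False
      have "continuous (at x within {0..2 * pi}) f"
        using contf x by (simp add: continuous_on_eq_continuous_within)
      then show ?thesis
        unfolding g_def using False by (intro continuous_intros) auto
    qed
  qed
  have derivg: "(g has_vector_derivative g' t) (at t)" if "t \<in> {0<..<2 * pi} - Z" for t
  proof -
    have sin: "sin (t - s) \<noteq> 0"
      using that by (auto simp: Z_def)
    have [derivative_intros]: "(f has_real_derivative f' t) (at t)"
      using deriv[of t] that at_within_interior[of t "{0..2 * pi}"] by auto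
    have "((\<lambda>t. (f t)\<^sup>2) has_real_derivative 2 * f t * f' t) (at t)"
      "((\<lambda>t. cos (t - s)) has_real_derivative - sin (t - s)) (at t)"
      "((\<lambda>t. sin (t - s)) has_real_derivative cos (t - s)) (at t)"
      by (auto intro!: derivative_eq_intros)
    then have "(g has_real_derivative
        ((2 * f t * f' t * cos (t - s) + (- sin (t - s)) * (f t)\<^sup>2) * sin (t - s)
          - (f t)\<^sup>2 * cos (t - s) * cos (t - s)) / (sin (t - s) * sin (t - s))) (at t)"
      unfolding g_def[abs_def] using sin by (intro DERIV_divide DERIV_mult)
    also have "((2 * f t * f' t * cos (t - s) + (- sin (t - s)) * (f t)\<^sup>2) * sin (t - s)
          - (f t)\<^sup>2 * cos (t - s) * cos (t - s)) / (sin (t - s) * sin (t - s)) = g' t"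
      unfolding g'_def using sin by (simp add: divide_simps power2_eq_square) algebra
    finally show ?thesis
      by (simp add: has_real_derivative_iff_has_vector_derivative)
  qed
  \<comment> \<open>\<open>g\<close> is continuous across the finite exceptional set
    \<open>Z\<close>, so the fundamental theorem reaches over the poles of the cotangent.\<close>
  have int: "(g' has_integral (g (2 * pi) - g 0)) {0..2 * pi}"
    using \<open>finite Z\<close> derivg contg by (intro fundamental_theorem_of_calculus_interior_strong) auto
  \<comment> \<open>The cotangent takes the same value at \<open>2 * pi - s\<close> and at
    \<open>- s\<close>, so periodicity of the square of \<open>f\<close> is enough for the boundary
    terms to cancel.\<close>
  have ends: "g (2 * pi) = g 0"
    using periodic
    by (simp add: g_def cos_diff sin_diff)
  \<comment> \<open>Completing the square treats the quotient \<open>cos / sin\<close> as a single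
    number, so the inequality also holds on \<open>Z\<close>, where that quotient is 0 by
    convention.\<close>
  have le: "g' t \<le> (f' t)\<^sup>2 - (f t)\<^sup>2" for t
  proof -
    have "(f' t)\<^sup>2 - (f t)\<^sup>2 - g' t = (f' t - f t * (cos (t - s) / sin (t - s)))\<^sup>2"
      unfolding g'_def by algebra
    then show ?thesis
      by (metis diff_ge_0_iff_ge zero_le_power2)
  qed
  have "((\<lambda>t. (f' t)\<^sup>2 - (f t)\<^sup>2) has_integral
      integral {0..2 * pi} (\<lambda>t. (f' t)\<^sup>2 - (f t)\<^sup>2)) {0..2 * pi}"
    by (intro integrable_integral integrable_continuous_real continuous_intros cont contf)
  from has_integral_le[OF int this le] show ?thesis
    by (simp add: ends)
qed

section \<open>Plane quadratic forms of negative trace\<close>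

text \<open>The expression is the form with matrix entries \<open>a\<close>, \<open>c\<close>,
  \<open>b\<close> at the unit vector \<open>(cos \<alpha>, - sin \<alpha>)\<close>. It equals half
  the trace plus \<open>r * cos (2 * \<alpha> + \<psi>)\<close>, and the cosine is nonpositive on
  half of its period \<open>pi\<close> in \<open>\<alpha>\<close>.\<close>

lemma quadratic_form_negative_quarter:
  fixes a b c :: real
  assumes "a + b < 0"
  obtains \<theta> where "\<And>\<alpha>. \<alpha> \<in> {\<theta>..<\<theta> + pi / 2} \<Longrightarrow>
    a * (cos \<alpha>)\<^sup>2 - 2 * c * (sin \<alpha> * cos \<alpha>) + b * (sin \<alpha>)\<^sup>2 < 0"
proof -
  \<comment> \<open>Polar form of the complex number with real part \<open>(a - b) / 2\<close> and
    imaginary part \<open>c\<close>.\<close>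
  obtain r \<psi> where r: "r \<ge> 0" and polar: "(a - b) / 2 = r * cos \<psi>" "c = r * sin \<psi>"
    by (metis complex.sel norm_ge_zero rcis_cmod_Arg Re_rcis Im_rcis)
  \<comment> \<open>On this interval \<open>2 * \<alpha> + \<psi>\<close> runs from
    \<open>pi / 2\<close> to \<open>3 * pi / 2\<close>.\<close>
  have "a * (cos \<alpha>)\<^sup>2 - 2 * c * (sin \<alpha> * cos \<alpha>) + b * (sin \<alpha>)\<^sup>2 < 0"
    if "\<alpha> \<in> {pi / 4 - \<psi> / 2..<pi / 4 - \<psi> / 2 + pi / 2}" for \<alpha>
  proof -
    have "cos (2 * \<alpha> + \<psi> - pi) \<ge> 0"
      using that by (intro cos_ge_zero) (auto simp: field_simps)
    then have "cos (2 * \<alpha> + \<psi>) \<le> 0"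
      by simp
    then have neg: "r * cos (2 * \<alpha> + \<psi>) \<le> 0"
      using r by (simp add: mult_nonneg_nonpos)
    have double: "r * cos (2 * \<alpha> + \<psi>)
        = (a - b) / 2 * ((cos \<alpha>)\<^sup>2 - (sin \<alpha>)\<^sup>2) - c * (2 * sin \<alpha> * cos \<alpha>)"
      unfolding polar cos_add cos_double sin_double by (simp add: algebra_simps)
    have "a * (cos \<alpha>)\<^sup>2 - 2 * c * (sin \<alpha> * cos \<alpha>) + b * (sin \<alpha>)\<^sup>2
        = (a + b) / 2 * ((sin \<alpha>)\<^sup>2 + (cos \<alpha>)\<^sup>2) + r * cos (2 * \<alpha> + \<psi>)"
      unfolding double by (simp add: field_simps del: sin_cos_squared_add sin_cos_squared_add2)
    then show ?thesis
      using neg assms by (simp add: add_neg_nonpos)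
  qed
  then show thesis
    by (rule that)
qed

section \<open>Regularity of eigenfunctions\<close>

text \<open>Passes from Lebesgue set integrals to the gauge integral, in whose terms the calculus
  below is carried out.\<close>

lemma antiderivative_of_integral:
  assumes "antiderivative_of f g"
  shows "g integrable_on {0..2 * pi}"
    and "s \<in> {0..2 * pi} \<Longrightarrow> f s = f 0 + integral {0..s} g"
proof -
  have g: "set_integrable lebesgue {0..2 * pi} g"
    using assms by (simp add: antiderivative_of_def)
  then show "g integrable_on {0..2 * pi}"
    by (rule set_lebesgue_integral_eq_integral)
  assume s: "s \<in> {0..2 * pi}"
  then have "set_integrable lebesgue {0..s} g"
    by (intro set_integrable_subset[OF g]) auto
  moreover have "f s = f 0 + (LINT t:{0..s}|lebesgue. g t)"
    using assms s unfolding antiderivative_of_def by blast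
  ultimately show "f s = f 0 + integral {0..s} g"
    using set_lebesgue_integral_eq_integral(2) by metis
qed

lemma antiderivative_of_continuous_on:
  assumes "antiderivative_of f g"
  shows "continuous_on {0..2 * pi} f"
proof -
  have "continuous_on {0..2 * pi} (\<lambda>s. f 0 + integral {0..s} g)"
    by (intro continuous_intros indefinite_integral_continuous_1 antiderivative_of_integral[OF assms])
  then show ?thesis
    by (rule continuous_on_eq) (rule antiderivative_of_integral(2)[OF assms, symmetric])
qed

text \<open>Changing the integrand on a null set does not affect its indefinite integral, so
  \<open>g\<close> may be replaced by its continuous representative \<open>h\<close>. The
  fundamental theorem then gives a derivative at every point, one-sided at the ends.\<close>

lemma antiderivative_of_derivative:
  assumes "antiderivative_of f g" and h: "continuous_on {0..2 * pi} h"
    and ae: "AE t in lebesgue. t \<in> {0..2 * pi} \<longrightarrow> g t = h t"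
    and s: "s \<in> {0..2 * pi}"
  shows "(f has_vector_derivative h s) (at s within {0..2 * pi})"
proof -
  obtain N where "N \<in> null_sets lebesgue"
      "\<And>t. t \<in> space lebesgue - N \<Longrightarrow> t \<in> {0..2 * pi} \<longrightarrow> g t = h t"
    using AE_E3[OF ae] by metis
  then have N: "negligible N" "\<And>t. t \<in> {0..2 * pi} \<Longrightarrow> t \<notin> N \<Longrightarrow> g t = h t"
    by (simp_all add: negligible_iff_null_sets)
  have "f t = f 0 + integral {0..t} h" if "t \<in> {0..2 * pi}" for t
  proof -
    have "integral {0..t} h = integral {0..t} g"
      using that by (intro integral_spike[OF N(1)]) (auto intro: N(2))
    then show ?thesis
      using antiderivative_of_integral(2)[OF assms(1) that] by metis
  qed
  then show ?thesis
  proof (rule has_vector_derivative_transform[OF s])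
    have "((\<lambda>t. f 0 + integral {0..t} h) has_vector_derivative 0 + h s) (at s within {0..2 * pi})"
      by (intro has_vector_derivative_add has_vector_derivative_const
          integral_has_vector_derivative h s)
    then show "((\<lambda>t. f 0 + integral {0..t} h) has_vector_derivative h s) (at s within {0..2 * pi})"
      by simp
  qed
qed

text \<open>Bootstrapping: \<open>u1\<close> is continuous, so \<open>u\<close> is continuously
  differentiable; the equation identifies \<open>u2\<close> almost everywhere with the continuous
  function \<open>(V - \<mu>) * u\<close>, so \<open>u1\<close> is too. As \<open>V\<close> and
  \<open>\<mu>\<close> are real, the real and imaginary parts solve the equation separately, and one
  of them is nonzero.\<close>

lemma schroedinger_eigenvalue_classical:
  assumes "schroedinger_eigenvalue V \<mu>" and V: "continuous_on {0..2 * pi} V"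
  obtains U U1 :: "real \<Rightarrow> real" where
    "\<And>t. t \<in> {0..2 * pi} \<Longrightarrow> (U has_real_derivative U1 t) (at t within {0..2 * pi})"
    "\<And>t. t \<in> {0..2 * pi} \<Longrightarrow> (U1 has_real_derivative (V t - \<mu>) * U t) (at t within {0..2 * pi})"
    "U (2 * pi) = U 0" "U1 (2 * pi) = U1 0" "\<exists>t\<in>{0..2 * pi}. U t \<noteq> 0"
proof -
  obtain u u1 u2 where u: "antiderivative_of u u1" "antiderivative_of u1 u2"
      "u (2 * pi) = u 0" "u1 (2 * pi) = u1 0"
    and eq: "AE s in lebesgue. s \<in> {0..2 * pi} \<longrightarrow> of_real \<mu> * u s = - u2 s + of_real (V s) * u s"
    and nz: "\<not> (AE s in lebesgue. s \<in> {0..2 * pi} \<longrightarrow> u s = 0)"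
    using assms(1) unfolding schroedinger_eigenvalue_def schroedinger_def H2_periodic_def by blast
  have contu: "continuous_on {0..2 * pi} u" and contu1: "continuous_on {0..2 * pi} u1"
    using u(1,2) antiderivative_of_continuous_on by blast+
  have eq': "AE s in lebesgue. s \<in> {0..2 * pi} \<longrightarrow> u2 s = of_real (V s - \<mu>) * u s"
    using eq by eventually_elim (auto simp: algebra_simps)
  have du: "(u has_vector_derivative u1 t) (at t within {0..2 * pi})"
    if "t \<in> {0..2 * pi}" for t
    using antiderivative_of_derivative[OF u(1) contu1 _ that] by simp
  have du1: "(u1 has_vector_derivative of_real (V t - \<mu>) * u t) (at t within {0..2 * pi})"
    if "t \<in> {0..2 * pi}" for t
    using that by (intro antiderivative_of_derivative[OF u(2) _ eq'] continuous_intros V contu)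
  have "\<exists>t0\<in>{0..2 * pi}. u t0 \<noteq> 0"
    using nz by auto
  then obtain t0 where "t0 \<in> {0..2 * pi}" "u t0 \<noteq> 0"
    by blast
  then consider "Re (u t0) \<noteq> 0" | "Im (u t0) \<noteq> 0"
    by (auto simp: complex_eq_iff)
  then show thesis
  proof cases
    case 1
    show thesis
    proof (rule that[of "\<lambda>t. Re (u t)" "\<lambda>t. Re (u1 t)"])
      fix t :: real assume t: "t \<in> {0..2 * pi}"
      show "((\<lambda>t. Re (u t)) has_real_derivative Re (u1 t)) (at t within {0..2 * pi})"
        using bounded_linear.has_vector_derivative[OF bounded_linear_Re du[OF t]]
        by (simp add: has_real_derivative_iff_has_vector_derivative)
      show "((\<lambda>t. Re (u1 t)) has_real_derivative (V t - \<mu>) * Re (u t)) (at t within {0..2 * pi})"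
        using bounded_linear.has_vector_derivative[OF bounded_linear_Re du1[OF t]]
        by (simp add: has_real_derivative_iff_has_vector_derivative)
    qed (use u 1 \<open>t0 \<in> _\<close> in auto)
  next
    case 2
    show thesis
    proof (rule that[of "\<lambda>t. Im (u t)" "\<lambda>t. Im (u1 t)"])
      fix t :: real assume t: "t \<in> {0..2 * pi}"
      show "((\<lambda>t. Im (u t)) has_real_derivative Im (u1 t)) (at t within {0..2 * pi})"
        using bounded_linear.has_vector_derivative[OF bounded_linear_Im du[OF t]]
        by (simp add: has_real_derivative_iff_has_vector_derivative)
      show "((\<lambda>t. Im (u1 t)) has_real_derivative (V t - \<mu>) * Im (u t)) (at t within {0..2 * pi})"
        using bounded_linear.has_vector_derivative[OF bounded_linear_Im du1[OF t]]
        by (simp add: has_real_derivative_iff_has_vector_derivative)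
    qed (use u 2 \<open>t0 \<in> _\<close> in auto)
  qed
qed

section \<open>Tangent angle and critical angles\<close>

lemma smooth_real_deriv:
  fixes f :: "real \<Rightarrow> real"
  assumes "smooth f"
  shows "(f has_real_derivative deriv f t) (at t)" and "continuous_on S (deriv f)"
proof -
  obtain D where D: "D 0 = f" "\<And>n t. (D n has_real_derivative D (Suc n) t) (at t)"
    using assms by (auto simp: smooth_def has_real_derivative_iff_has_vector_derivative)
  have "deriv f = D 1"
    using D(2)[of 0] D(1) by (auto intro!: ext DERIV_imp_deriv)
  then show "(f has_real_derivative deriv f t) (at t)" and "continuous_on S (deriv f)"
    using D(1) D(2)[of 0] DERIV_continuous_on[of S "D 1" "D 2"] D(2)[of 1]
    by (auto simp: numeral_2_eq_2 intro: has_field_derivative_at_within)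
qed

lemma smooth_vector_derivative_periodic:
  assumes "smooth \<gamma>" and "\<And>s. \<gamma> (s + p) = \<gamma> s"
  shows "vector_derivative \<gamma> (at (s + p)) = vector_derivative \<gamma> (at s)"
proof -
  obtain D where D: "\<And>t. (\<gamma> has_vector_derivative D t) (at t)"
    using assms(1) unfolding smooth_def by metis
  have "((\<gamma> \<circ> (\<lambda>t. t + p)) has_vector_derivative 1 *\<^sub>R D (s + p)) (at s)"
    by (rule vector_diff_chain_at[OF _ D]) (auto intro!: derivative_eq_intros)
  then have "(\<gamma> has_vector_derivative D (s + p)) (at s)"
    by (simp add: o_def assms(2))
  then show ?thesis
    using D vector_derivative_at by metis
qed

lemma cis_eq_cis_iff: "cis a = cis b \<longleftrightarrow> (\<exists>n::int. a = b + 2 * pi * n)"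
  using sin_cos_eq_iff[of a b] by (auto simp: complex_eq_iff)

text \<open>Periodicity of the tangent forces the increment of \<open>\<phi>\<close> over one period
  to be a multiple of \<open>2 * pi\<close>. By continuity the multiple does not depend on
  \<open>s\<close>, and the total turning determines it at \<open>s = 0\<close>.\<close>

lemma strictly_convex_loop_angle:
  assumes "strictly_convex_loop \<gamma> \<phi>"
  shows "\<phi> (s + 2 * pi) = \<phi> s + 2 * pi"
proof -
  note defs = strictly_convex_loop_def arclength_loop_def tangent_angle_def
  have smooth: "smooth \<gamma>" "smooth \<phi>" and periodic: "\<And>s. \<gamma> (s + 2 * pi) = \<gamma> s"
    and tangent: "\<And>s. vector_derivative \<gamma> (at s) = cis (\<phi> s)"
    and turning: "integral {0..2 * pi} (deriv \<phi>) = 2 * pi"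
    using assms by (auto simp: defs)
  define h where "h s = \<phi> (s + 2 * pi) - \<phi> s" for s
  have h_int: "\<exists>n::int. h s = 2 * pi * n" for s
  proof -
    have "cis (\<phi> (s + 2 * pi)) = cis (\<phi> s)"
      using smooth_vector_derivative_periodic[OF smooth(1) periodic] tangent by simp
    then show ?thesis
      by (auto simp: cis_eq_cis_iff h_def)
  qed
  have cont: "continuous_on S \<phi>" for S
    using smooth_real_deriv(1)[OF smooth(2)] DERIV_isCont
    by (blast intro: continuous_at_imp_continuous_on)
  have "h constant_on UNIV"
  proof (rule continuous_discrete_range_constant)
    show "continuous_on UNIV h"
      unfolding h_def by (intro continuous_intros continuous_on_compose2[OF cont[of UNIV]] cont) auto
    fix x
    \<comment> \<open>Distinct multiples of \<open>2 * pi\<close> are at least \<open>2 * pi\<close>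
      apart, so the continuous \<open>h\<close> has discrete range.\<close>
    have "2 * pi \<le> norm (h y - h x)" if "h y \<noteq> h x" for y
    proof -
      obtain m n :: int where mn: "h x = 2 * pi * m" "h y = 2 * pi * n"
        using h_int by meson
      then have "n \<noteq> m"
        using that by auto
      then have "1 \<le> \<bar>real_of_int (n - m)\<bar>"
        by linarith
      then have "2 * pi * 1 \<le> 2 * pi * \<bar>real_of_int (n - m)\<bar>"
        by (intro mult_left_mono) auto
      also have "\<dots> = norm (h y - h x)"
        unfolding mn by (simp add: abs_mult flip: right_diff_distrib)
      finally show ?thesis by simp
    qed
    then show "\<exists>e>0. \<forall>y. y \<in> UNIV \<and> h y \<noteq> h x \<longrightarrow> e \<le> norm (h y - h x)"
      by (intro exI[of _ "2 * pi"]) auto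
  qed simp
  then have "h s = h 0"
    unfolding constant_on_def by auto
  also have "h 0 = 2 * pi"
  proof -
    have "(deriv \<phi> has_integral (\<phi> (2 * pi) - \<phi> 0)) {0..2 * pi}"
      using smooth_real_deriv(1)[OF smooth(2)]
      by (intro fundamental_theorem_of_calculus)
        (auto simp: has_real_derivative_iff_has_vector_derivative[symmetric]
          intro: has_field_derivative_at_within)
    then show ?thesis
      using turning by (simp add: h_def integral_unique)
  qed
  finally show ?thesis
    by (simp add: h_def)
qed

text \<open>Modulo \<open>2 * pi\<close>, the zeros of \<open>sin (t - s)\<close> are a critical
  point and its antipode, and at both of them the tangent is parallel to the direction
  \<open>\<alpha>\<close>.\<close>

lemma critical_angle_antipodal:
  assumes periodic: "\<And>s. \<phi> (s + 2 * pi) = \<phi> s + 2 * pi" and "critical_angle \<phi> \<alpha>"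
  obtains s where "\<And>t. sin (t - s) = 0 \<Longrightarrow> sin (\<phi> t - \<alpha>) = 0"
proof -
  obtain s and m n :: int where s: "\<phi> s + pi = \<phi> (s + pi) + of_int m * (2 * pi)"
      "\<phi> s = \<alpha> + of_int n * (2 * pi)"
    using assms(2) unfolding critical_angle_def critical_point_def rcong_altdef by blast
  have even: "\<phi> (t + of_int k * (2 * pi)) = \<phi> t + of_int k * (2 * pi)" for t and k :: int
  proof (induction k rule: int_induct[where k = 0])
    case (step1 i)
    then show ?case
      using periodic[of "t + of_int i * (2 * pi)"] by (simp add: algebra_simps)
  next
    case (step2 i)
    then show ?case
      using periodic[of "t + of_int (i - 1) * (2 * pi)"] by (simp add: algebra_simps)
  qed simp
  have "sin (\<phi> t - \<alpha>) = 0" if t: "sin (t - s) = 0" for t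
  proof -
    obtain k :: int where k: "t - s = of_int k * pi"
      using t unfolding sin_zero_iff_int2 by blast
    \<comment> \<open>Even \<open>k\<close> leads to translates of \<open>s\<close>, odd
      \<open>k\<close> to translates of \<open>s + pi\<close>, where criticality enters.\<close>
    consider j where "k = 2 * j" | j where "k = 2 * j + 1"
      by (metis evenE oddE)
    then have "\<exists>i::int. \<phi> t - \<alpha> = of_int i * pi"
    proof cases
      case 1
      then have "t = s + of_int j * (2 * pi)"
        using k by (simp add: algebra_simps)
      then have "\<phi> t - \<alpha> = of_int (2 * n + 2 * j) * pi"
        using even[of s j] s by (simp add: algebra_simps)
      then show ?thesis by blast
    next
      case 2
      then have "t = s + pi + of_int j * (2 * pi)"
        using k by (simp add: algebra_simps)
      then have "\<phi> t - \<alpha> = of_int (2 * n + 2 * j + 1 - 2 * m) * pi"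
        using even[of "s + pi" j] s by (simp add: algebra_simps)
      then show ?thesis by blast
    qed
    then show ?thesis
      unfolding sin_zero_iff_int2 .
  qed
  then show thesis
    by (rule that)
qed

section \<open>The quadratic form of an eigenfunction\<close>

theorem theorem2p2:
  fixes \<gamma> :: "real \<Rightarrow> complex" and \<phi> \<kappa> :: "real \<Rightarrow> real" and lam :: real
  assumes "strictly_convex_loop \<gamma> \<phi>"
    and "\<kappa> = deriv \<phi>"
    and "lowest_eigenvalue (\<lambda>s. (\<kappa> s)\<^sup>2) lam"
    and "\<forall>\<theta>. \<exists>\<alpha>\<in>{\<theta>..<\<theta> + pi / 2}. critical_angle \<phi> \<alpha>"
  shows "lam \<ge> 1"
proof (rule ccontr)
  assume "\<not> lam \<ge> 1"
  let ?I = "{0..2 * pi}"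
  have "smooth \<phi>"
    using assms(1) by (simp add: strictly_convex_loop_def tangent_angle_def)
  then have d\<phi>: "\<And>t. (\<phi> has_real_derivative \<kappa> t) (at t within ?I)" 
    and cont\<kappa>: "continuous_on ?I \<kappa>"
    using smooth_real_deriv assms(2) by (auto intro: has_field_derivative_at_within)
  have "schroedinger_eigenvalue (\<lambda>s. (\<kappa> s)\<^sup>2) lam"
    using assms(3) by (simp add: lowest_eigenvalue_def)
  moreover have "continuous_on ?I (\<lambda>s. (\<kappa> s)\<^sup>2)"
    by (intro continuous_intros cont\<kappa>)
  ultimately obtain U U1 where
    dU: "\<And>t. t \<in> ?I \<Longrightarrow> (U has_real_derivative U1 t) (at t within ?I)" and
    dU1: "\<And>t. t \<in> ?I \<Longrightarrow> (U1 has_real_derivative ((\<kappa> t)\<^sup>2 - lam) * U t) (at t within ?I)" and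
    U: "U (2 * pi) = U 0" "U1 (2 * pi) = U1 0" "\<exists>t\<in>?I. U t \<noteq> 0"
    by (rule schroedinger_eigenvalue_classical) blast
  have contU: "continuous_on ?I U" and contU1: "continuous_on ?I U1"
    and cont\<phi>: "continuous_on ?I \<phi>"
    using DERIV_continuous_on[of ?I U U1, OF dU]
      DERIV_continuous_on[of ?I U1 "\<lambda>t. ((\<kappa> t)\<^sup>2 - lam) * U t", OF dU1]
      DERIV_continuous_on[of ?I \<phi> \<kappa>, OF d\<phi>] by simp_all
  note cont = continuous_intros contU contU1 cont\<phi> cont\<kappa>
  \<comment> \<open>The coordinates of the curve \<open>Y\<close>, in swapped order:
    \<open>x\<close> is the sine coordinate and \<open>y\<close> the cosine coordinate.\<close>
  define x where "x t = U t * sin (\<phi> t)" for t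
  define y where "y t = U t * cos (\<phi> t)" for t
  define x' where "x' t = U1 t * sin (\<phi> t) + U t * \<kappa> t * cos (\<phi> t)" for t
  define y' where "y' t = U1 t * cos (\<phi> t) - U t * \<kappa> t * sin (\<phi> t)" for t
  have dx: "(x has_real_derivative x' t) (at t within ?I)"
    and dy: "(y has_real_derivative y' t) (at t within ?I)" if "t \<in> ?I" for t
    unfolding x_def y_def x'_def y'_def
    by (auto intro!: derivative_eq_intros dU[OF that] d\<phi>)
  have contx: "continuous_on ?I x" "continuous_on ?I y" "continuous_on ?I x'" "continuous_on ?I y'"
    unfolding x_def y_def x'_def y'_def by (intro cont)+
  have angle: "\<phi> (s + 2 * pi) = \<phi> s + 2 * pi" for s
    using strictly_convex_loop_angle[OF assms(1)] .
  have ends: "x (2 * pi) = x 0" "y (2 * pi) = y 0"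
    using angle[of 0] U by (auto simp: x_def y_def)

  \<comment> \<open>Matrix entries of the form \<open>Q\<close>: \<open>a\<close> and
    \<open>b\<close> on the diagonal, \<open>c\<close> off it.\<close>
  define a where "a = integral ?I (\<lambda>t. (x' t)\<^sup>2 - (x t)\<^sup>2)"
  define b where "b = integral ?I (\<lambda>t. (y' t)\<^sup>2 - (y t)\<^sup>2)"
  define c where "c = integral ?I (\<lambda>t. x' t * y' t - x t * y t)"
  have ints: "(\<lambda>t. (x' t)\<^sup>2 - (x t)\<^sup>2) integrable_on ?I" "(\<lambda>t. (y' t)\<^sup>2 - (y t)\<^sup>2) integrable_on ?I"
    "(\<lambda>t. x' t * y' t - x t * y t) integrable_on ?I" "(\<lambda>t. (U t)\<^sup>2) integrable_on ?I"
    by (intro integrable_continuous_real continuous_intros contx contU)+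

  have "a + b = (lam - 1) * integral ?I (\<lambda>t. (U t)\<^sup>2)"
  proof -
    have form: "((\<lambda>t. (x' t)\<^sup>2 - (x t)\<^sup>2 + ((y' t)\<^sup>2 - (y t)\<^sup>2) - (lam - 1) * (U t)\<^sup>2)
        has_integral a + b - (lam - 1) * integral ?I (\<lambda>t. (U t)\<^sup>2)) ?I"
      unfolding a_def b_def
      by (intro has_integral_add has_integral_diff has_integral_mult_right integrable_integral ints)
    \<comment> \<open>The rotation by \<open>\<phi>\<close> drops out of the sums of squares, and
      the remaining integrand is the derivative of \<open>U1 * U\<close> by the eigenvalue equation.
      Its integral vanishes by periodicity.\<close>
    have "(x' t)\<^sup>2 - (x t)\<^sup>2 + ((y' t)\<^sup>2 - (y t)\<^sup>2) - (lam - 1) * (U t)\<^sup>2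
        = U1 t * U1 t + ((\<kappa> t)\<^sup>2 - lam) * U t * U t" for t
      using sin_cos_squared_add[of "\<phi> t"] unfolding x_def y_def x'_def y'_def by algebra
    moreover have "((\<lambda>t. U1 t * U1 t + ((\<kappa> t)\<^sup>2 - lam) * U t * U t)
        has_integral U1 (2 * pi) * U (2 * pi) - U1 0 * U 0) ?I"
    proof (intro fundamental_theorem_of_calculus)
      fix t assume t: "t \<in> ?I"
      show "((\<lambda>t. U1 t * U t) has_vector_derivative
          U1 t * U1 t + ((\<kappa> t)\<^sup>2 - lam) * U t * U t) (at t within ?I)"
        unfolding has_real_derivative_iff_has_vector_derivative[symmetric]
        by (auto intro!: derivative_eq_intros dU[OF t] dU1[OF t])
    qed simp
    ultimately have "((\<lambda>t. (x' t)\<^sup>2 - (x t)\<^sup>2 + ((y' t)\<^sup>2 - (y t)\<^sup>2) - (lam - 1) * (U t)\<^sup>2)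
        has_integral 0) ?I"
      using U(1,2) by simp
    from has_integral_unique[OF form this] show ?thesis
      by simp
  qed
  moreover have "integral ?I (\<lambda>t. (U t)\<^sup>2) > 0"
  proof -
    have "continuous_on ?I (\<lambda>t. (U t)\<^sup>2)"
      by (intro continuous_intros contU)
    then have "integral ?I (\<lambda>t. (U t)\<^sup>2) \<noteq> 0"
      using integral_eq_0_iff[of 0 "2 * pi" "\<lambda>t. (U t)\<^sup>2"] U(3) by simp
    then show ?thesis
      using integral_nonneg[OF ints(4)] by (simp add: less_le)
  qed
  ultimately have "a + b < 0"
    using \<open>\<not> lam \<ge> 1\<close> by (simp add: mult_neg_pos)
  then obtain \<theta> where \<theta>: "\<And>\<alpha>. \<alpha> \<in> {\<theta>..<\<theta> + pi / 2} \<Longrightarrow>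
    a * (cos \<alpha>)\<^sup>2 - 2 * c * (sin \<alpha> * cos \<alpha>) + b * (sin \<alpha>)\<^sup>2 < 0"
    using quadratic_form_negative_quarter by metis
  obtain \<alpha> where \<alpha>: "\<alpha> \<in> {\<theta>..<\<theta> + pi / 2}" "critical_angle \<phi> \<alpha>"
    using assms(4) by blast
  obtain s where s: "\<And>t. sin (t - s) = 0 \<Longrightarrow> sin (\<phi> t - \<alpha>) = 0"
    using critical_angle_antipodal[OF angle \<alpha>(2)] by blast

  \<comment> \<open>The component of \<open>Y\<close> along the normal
    \<open>(- sin \<alpha>, cos \<alpha>)\<close> to the critical direction. It equals
    \<open>U * sin (\<phi> - \<alpha>)\<close>, hence vanishes wherever \<open>sin (t - s)\<close>
    does.\<close>
  define f where "f t = cos \<alpha> * x t - sin \<alpha> * y t" for t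
  define f' where "f' t = cos \<alpha> * x' t - sin \<alpha> * y' t" for t
  have f_eq: "f t = U t * sin (\<phi> t - \<alpha>)" for t
    by (simp add: f_def x_def y_def sin_diff algebra_simps)
  \<comment> \<open>Bilinear expansion of \<open>Q\<close> at this normal, which recovers the
    expression that is negative at \<open>\<alpha>\<close>.\<close>
  have "((\<lambda>t. (cos \<alpha>)\<^sup>2 * ((x' t)\<^sup>2 - (x t)\<^sup>2) - 2 * sin \<alpha> * cos \<alpha> * (x' t * y' t - x t * y t)
      + (sin \<alpha>)\<^sup>2 * ((y' t)\<^sup>2 - (y t)\<^sup>2))
      has_integral (cos \<alpha>)\<^sup>2 * a - 2 * sin \<alpha> * cos \<alpha> * c + (sin \<alpha>)\<^sup>2 * b) ?I"
    unfolding a_def b_def c_def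
    by (intro has_integral_add has_integral_diff has_integral_mult_right integrable_integral ints)
  moreover have "(cos \<alpha>)\<^sup>2 * ((x' t)\<^sup>2 - (x t)\<^sup>2) - 2 * sin \<alpha> * cos \<alpha> * (x' t * y' t - x t * y t)
      + (sin \<alpha>)\<^sup>2 * ((y' t)\<^sup>2 - (y t)\<^sup>2) = (f' t)\<^sup>2 - (f t)\<^sup>2" for t
    unfolding f_def f'_def by algebra
  ultimately have "((\<lambda>t. (f' t)\<^sup>2 - (f t)\<^sup>2)
      has_integral (cos \<alpha>)\<^sup>2 * a - 2 * sin \<alpha> * cos \<alpha> * c + (sin \<alpha>)\<^sup>2 * b) ?I"
    by simp
  then have "integral ?I (\<lambda>t. (f' t)\<^sup>2 - (f t)\<^sup>2)
      = a * (cos \<alpha>)\<^sup>2 - 2 * c * (sin \<alpha> * cos \<alpha>) + b * (sin \<alpha>)\<^sup>2"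
    by (simp add: integral_unique mult_ac)
  then have "integral ?I (\<lambda>t. (f' t)\<^sup>2 - (f t)\<^sup>2) < 0"
    using \<theta>[OF \<alpha>(1)] by simp
  moreover have "integral ?I (\<lambda>t. (f' t)\<^sup>2 - (f t)\<^sup>2) \<ge> 0"
  proof (rule wirtinger_antipodal_zeros[where s = s])
    show "(f has_real_derivative f' t) (at t within ?I)" if "t \<in> ?I" for t
      unfolding f_def f'_def by (auto intro!: derivative_eq_intros dx[OF that] dy[OF that])
    show "continuous_on ?I f'"
      unfolding f'_def by (intro continuous_intros contx)
    show "(f (2 * pi))\<^sup>2 = (f 0)\<^sup>2"
      by (simp add: f_def ends)
    show "f t = 0" if "sin (t - s) = 0" for t
      using s[OF that] by (simp add: f_eq)
  qed
  ultimately show False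
    by simp
qed

end
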